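(* Let $n\ge 2$ and let $$A=\begin{bmatrix} 0 & w_1 & & \\ & 0 & \ddots & \\ & & \ddots & w_{n-1} \\ {w_n} & & & 0 \end{bmatrix}$$ be an $n$-by-$n$ complex matrix with $w_j\ne 0$ for all $j$. Then $d(A)=\lfloor n/2\rfloor$. Moreover, let $\alpha=\sum_{j=1}^n\arg w_j$. If $n$ is even, then $d(A)=i_{\ge 0}(\mathrm{Re}(e^{-i\theta}A))$ for all but finitely many values of $\theta$ in any finite interval of $\mathbb{R}$. If $n$ is odd, then $d(A)=i_{\ge 0}(\mathrm{Re}(e^{-i\theta}A))$ for all $\theta$ in $$\bigcup_{m=-\infty}^{\infty}\left(\tfrac1n\left(\alpha+\tfrac{\pi}{2}+2m\pi\right),\tfrac1n\left(\alpha+\tfrac{3\pi}{2}+2m\pi\right)\right)$$ when $(n-1)/2$ is even, and for all $\theta$ in $$\bigcup_{m=-\infty}^{\infty}\left(\tfrac1n\left(\alpha-\tfrac{\pi}{2}+2m\pi\right),\tfrac1n\left(\alpha+\tfrac{\pi}{2}+2m\pi\right)\right)$$ when $(n-1)/2$ is odd.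
   Context: For an $n$-by-$n$ complex matrix $A$, the zero-dilation index $d(A)$ is the largest integer $k\ge 1$ such that there is an $n$-by-$k$ complex matrix $V$ with $V^*V=I_k$ and $V^*AV=0_k$, where $0_k$ is the $k$-by-$k$ zero matrix; if no such $k$ exists, $d(A)=0$. $\mathrm{Re}\,B=(B+B^* )/2$. For a Hermitian matrix $C$, $i_{\ge 0}(C)$ is the number of nonnegative eigenvalues of $C$, counting multiplicity. For a nonzero complex number $z$, $\arg z$ is the unique $\theta\in[0,2\pi)$ with $z=|z|e^{i\theta}$. The only nonzero entries of $A$ are the $(j,j+1)$ entries $w_j$, $1\le j\le n-1$, and the $(n,1)$ entry $w_n$. *)

theory Defs
  imports
    "HOL-Analysis.Complex_Transcendental"
    "Jordan_Normal_Form.Spectral_Radius"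
    "Jordan_Normal_Form.Schur_Decomposition"
begin

definition zero_dilation :: "complex mat \<Rightarrow> nat \<Rightarrow> bool" where
  "zero_dilation A k \<longleftrightarrow>
     (\<exists>V \<in> carrier_mat (dim_row A) k.
        mat_adjoint V * V = 1\<^sub>m k \<and> mat_adjoint V * A * V = 0\<^sub>m k k)"

(* V^* V = I_k forces k \<le> dim_row A, so the greatest element exists whenever some k does. *)
definition zero_dilation_index :: "complex mat \<Rightarrow> nat" where
  "zero_dilation_index A =
     (if \<exists>k \<ge> 1. zero_dilation A k then (GREATEST k. k \<ge> 1 \<and> zero_dilation A k) else 0)"

definition re_part :: "complex mat \<Rightarrow> complex mat" where
  "re_part B = (1 / 2) \<cdot>\<^sub>m (B + mat_adjoint B)"

(* Meant for Hermitian C, whose eigenvalues are all real and whose algebraic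
   multiplicities (counted here) coincide with the geometric ones. *)
definition num_nonneg_eigenvalues :: "complex mat \<Rightarrow> nat" where
  "num_nonneg_eigenvalues C =
     (\<Sum>x \<in> {x \<in> spectrum C. x \<in> \<real> \<and> Re x \<ge> 0}. Polynomial.order x (char_poly C))"

(* Matrix indices start at 0, but the weights keep their usual numbering w 1, ..., w n;
   the two nonzero cases do not overlap for n \<ge> 2. *)
definition weighted_cyclic_mat :: "nat \<Rightarrow> (nat \<Rightarrow> complex) \<Rightarrow> complex mat" where
  "weighted_cyclic_mat n w =
     mat n n (\<lambda>(i, j). if j = i + 1 then w (i + 1)
                        else if i = n - 1 \<and> j = 0 then w n
                        else 0)"

end

theory Submission
  imports Defs
begin

text \<open>Write $H_\theta$ for the Hermitian matrix $\mathrm{Re}(e^{-i\theta}A)$. If $V^*V = I_k$ and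
$V^*AV = 0$, the Hermitian form of $H_\theta$ vanishes on the range of $V$, which forces
$k \le i_{\ge 0}(H_\theta)$ for every $\theta$. The unit vectors $e_0, e_2, e_4, \dots$ give such a $V$
with $k = \lfloor n/2\rfloor$, so it suffices to show $i_{\ge 0}(H_\theta) \le \lfloor n/2\rfloor$ for the
stated angles; the upper bound on $d(A)$ then comes from any one of them.

For even $n$ the isotropic subspace also gives $i_{\ge 0}(H_\theta) \le n/2$ as soon as $H_\theta$ is
invertible, and $H_\theta$ is singular only if $e^{-2i\theta}$ is an eigenvalue of $-A^{-1}A^*$.
For $n = 2k+1$ one adds a vector $u$ that is $H_\theta$-orthogonal to $e_0, e_2, \dots, e_{2k-2}$. Then
$u^*H_\theta u$ has the sign of $(-1)^k\cos(n\theta-\alpha)$, and when this is negative the form is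
nonpositive on a $(k+1)$-dimensional subspace on which $H_\theta$ is injective.\<close>

unbundle no vec_syntax

subsection \<open>Hermitian matrices and inertia\<close>

lemma dim_mat_adjoint[simp]:
  "dim_row (mat_adjoint A) = dim_col A" "dim_col (mat_adjoint A) = dim_row A"
  by (simp_all add: mat_adjoint_def)

lemma mat_adjoint_carrier[simp]:
  "A \<in> carrier_mat n m \<Longrightarrow> mat_adjoint A \<in> carrier_mat m n"
  by (intro carrier_matI) auto

lemma index_mat_adjoint[simp]:
  "i < dim_col A \<Longrightarrow> j < dim_row A \<Longrightarrow> mat_adjoint A $$ (i, j) = conjugate (A $$ (j, i))"
  by (simp add: mat_adjoint_def mat_of_rows_def)

lemma mat_adjoint_adjoint[simp]: "mat_adjoint (mat_adjoint A) = A"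
  by (rule eq_matI) auto

lemma mat_adjoint_one[simp]: "mat_adjoint (1\<^sub>m n :: complex mat) = 1\<^sub>m n"
  by (rule eq_matI) auto

lemma mat_adjoint_mult:
  fixes A B :: "complex mat"
  assumes "A \<in> carrier_mat n m" "B \<in> carrier_mat m k"
  shows "mat_adjoint (A * B) = mat_adjoint B * mat_adjoint A"
  using assms by (intro eq_matI) (auto simp: scalar_prod_def mult.commute intro!: sum.cong)

lemma mat_adjoint_smult:
  fixes A :: "complex mat"
  shows "mat_adjoint (c \<cdot>\<^sub>m A) = cnj c \<cdot>\<^sub>m mat_adjoint A"
  by (intro eq_matI) auto

lemma cscalar_prod_mat_adjoint:
  fixes A :: "complex mat"
  assumes "A \<in> carrier_mat n m" "x \<in> carrier_vec m" "y \<in> carrier_vec n"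
  shows "(A *\<^sub>v x) \<bullet>c y = x \<bullet>c (mat_adjoint A *\<^sub>v y)"
proof -
  have "(A *\<^sub>v x) \<bullet>c y = (\<Sum>i<n. \<Sum>j<m. A $$ (i, j) * x $ j * cnj (y $ i))"
    using assms by (simp add: scalar_prod_def sum_distrib_right atLeast0LessThan)
  also have "\<dots> = (\<Sum>j<m. \<Sum>i<n. A $$ (i, j) * x $ j * cnj (y $ i))"
    by (rule sum.swap)
  also have "\<dots> = x \<bullet>c (mat_adjoint A *\<^sub>v y)"
    using assms by (simp add: scalar_prod_def sum_distrib_left sum_distrib_right atLeast0LessThan mult_ac)
  finally show ?thesis .
qed

section \<open>Unitary diagonalization of Hermitian matrices\<close>

text \<open>Complete \<open>v\<close> to a basis, orthogonalize, and normalize each vector. This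
  Gram-Schmidt process does not normalize and keeps the first vector, so the first column is only a
  multiple of \<open>v\<close>; that is enough for an eigenvector.\<close>

lemma unitary_extending_unit_vector:
  fixes v :: "complex vec"
  assumes v: "v \<in> carrier_vec n" and v0: "v \<noteq> 0\<^sub>v n"
  obtains W c where "W \<in> carrier_mat n n" "mat_adjoint W * W = 1\<^sub>m n" "col W 0 = c \<cdot>\<^sub>v v"
proof -
  interpret cof_vec_space n "TYPE(complex)" .
  define b where "b = basis_completion v"
  define ws where "ws = gram_schmidt n b"
  from basis_completion[OF v v0, folded b_def]
  have dist_b: "distinct b" and indep: "\<not> lin_dep (set b)" and b: "set b \<subseteq> carrier_vec n"
    and hdb: "hd b = v" and len_b: "length b = n" by auto
  have n: "n \<noteq> 0" using v v0 by (metis carrier_vecD eq_vecI index_zero_vec(2) less_nat_zero_code)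
  from hdb len_b n obtain vs where bv: "b = v # vs" by (cases b) auto
  from gram_schmidt_result[OF b dist_b indep refl, folded ws_def]
  have ws: "set ws \<subseteq> carrier_vec n" "corthogonal ws" "length ws = n"
    by (auto simp: len_b)
  from gram_schmidt_hd[OF v, of vs, folded bv] have hdws: "hd ws = v" unfolding ws_def .
  with n ws(3) have ws0: "ws ! 0 = v" by (cases ws) auto
  \<comment> \<open>\<open>s j\<close> is the reciprocal of the Euclidean norm of
    \<open>ws ! j\<close>, so scaling by it turns the orthogonal family into an orthonormal
    one.\<close>
  define s :: "nat \<Rightarrow> complex" where "s j = of_real (1 / sqrt (\<Sum>i<n. (cmod (ws ! j $ i))\<^sup>2))" for j
  define W where "W = mat n n (\<lambda>(i, j). s j * ws ! j $ i)"
  have W: "W \<in> carrier_mat n n" by (simp add: W_def)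
  have wsj: "ws ! j \<in> carrier_vec n" if "j < n" for j
    using ws that by auto
  have "mat_adjoint W * W = 1\<^sub>m n"
  proof (rule eq_matI)
    fix i j assume "i < dim_row (1\<^sub>m n :: complex mat)" "j < dim_col (1\<^sub>m n :: complex mat)"
    hence ij: "i < n" "j < n" by auto
    have "(mat_adjoint W * W) $$ (i, j) = (\<Sum>l<n. cnj (s i * ws ! i $ l) * (s j * ws ! j $ l))"
      using ij by (simp add: W_def scalar_prod_def atLeast0LessThan)
    also have "\<dots> = cnj (s i) * s j * (\<Sum>l<n. ws ! j $ l * cnj (ws ! i $ l))"
      by (simp add: sum_distrib_left mult_ac)
    also have "(\<Sum>l<n. ws ! j $ l * cnj (ws ! i $ l)) = ws ! j \<bullet>c ws ! i"
      using wsj[OF ij(1)] by (simp add: scalar_prod_def atLeast0LessThan)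
    finally have eq: "(mat_adjoint W * W) $$ (i, j) = cnj (s i) * s j * (ws ! j \<bullet>c ws ! i)" .
    show "(mat_adjoint W * W) $$ (i, j) = 1\<^sub>m n $$ (i, j)"
    proof (cases "i = j")
      case False
      thus ?thesis using eq ij corthogonalD[OF ws(2)] ws(3) by simp
    next
      case True
      define t where "t = (\<Sum>l<n. (cmod (ws ! i $ l))\<^sup>2)"
      have sp: "ws ! i \<bullet>c ws ! i = of_real t"
        using wsj[OF ij(1)] by (simp add: scalar_prod_def atLeast0LessThan t_def complex_norm_square[symmetric])
      moreover have "ws ! i \<bullet>c ws ! i \<noteq> 0"
        using ij corthogonalD[OF ws(2), of i i] ws(3) by simp
      ultimately have t0: "t \<noteq> 0" by auto
      have "t \<ge> 0" by (simp add: t_def sum_nonneg)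
      with t0 have "t > 0" by simp
      hence "(1 / sqrt t) * (1 / sqrt t) * t = 1" by (simp add: field_simps)
      hence "complex_of_real (1 / sqrt t) * of_real (1 / sqrt t) * of_real t = 1"
        by (metis of_real_1 of_real_mult)
      thus ?thesis using eq True sp ij unfolding s_def t_def by simp
    qed
  qed (use W in auto)
  moreover have "col W 0 = s 0 \<cdot>\<^sub>v v"
    using n v ws0 by (intro eq_vecI) (auto simp: W_def)
  ultimately show thesis using that W by blast
qed

lemma mat_adjoint_four_block_diag:
  fixes A B :: "complex mat"
  assumes "A \<in> carrier_mat n n" "B \<in> carrier_mat m m"
  shows "mat_adjoint (four_block_mat A (0\<^sub>m n m) (0\<^sub>m m n) B)
       = four_block_mat (mat_adjoint A) (0\<^sub>m n m) (0\<^sub>m m n) (mat_adjoint B)"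
  using assms by (intro eq_matI) (auto simp: index_mat_four_block)

text \<open>Deflation: in an orthonormal basis that starts with an eigenvector, the first column of
  the matrix is a multiple of the first unit vector. Being Hermitian, the matrix then has the same
  shape in its first row, so it splits into a 1-by-1 block and a smaller Hermitian block, to which
  the induction hypothesis applies.\<close>

theorem hermitian_diagonalization:
  fixes H :: "complex mat"
  assumes "H \<in> carrier_mat n n" "mat_adjoint H = H"
  obtains U D where "U \<in> carrier_mat n n" "D \<in> carrier_mat n n" "diagonal_mat D"
    "mat_adjoint U * U = 1\<^sub>m n" "H = U * D * mat_adjoint U"
proof -
  have "\<exists>U D. U \<in> carrier_mat n n \<and> D \<in> carrier_mat n n \<and> diagonal_mat D \<and>
    mat_adjoint U * U = 1\<^sub>m n \<and> H = U * D * mat_adjoint U"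
    using assms
  proof (induction n arbitrary: H)
    case 0
    thus ?case by (intro exI[of _ "1\<^sub>m 0"]) (auto simp: diagonal_mat_def)
  next
    case (Suc m)
    let ?n = "Suc m"
    note H = Suc.prems(1) and herm = Suc.prems(2)
    from spectrum_non_empty[OF H] obtain e v where ev: "eigenvector H v e"
      by (auto simp: spectrum_def eigenvalue_def)
    hence v: "v \<in> carrier_vec ?n" and v0: "v \<noteq> 0\<^sub>v ?n" and Hv: "H *\<^sub>v v = e \<cdot>\<^sub>v v"
      using H by (auto simp: eigenvector_def)
    from unitary_extending_unit_vector[OF v v0] obtain W c where
      W: "W \<in> carrier_mat ?n ?n" and WW: "mat_adjoint W * W = 1\<^sub>m ?n" and c: "col W 0 = c \<cdot>\<^sub>v v" .
    define W' where "W' = mat_adjoint W"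
    have W': "W' \<in> carrier_mat ?n ?n" using W by (simp add: W'_def)
    have WW1: "W' * W = 1\<^sub>m ?n" using WW by (simp add: W'_def)
    have WW2: "W * W' = 1\<^sub>m ?n" using mat_mult_left_right_inverse[OF W' W WW1] .
    define K where "K = W' * H * W"
    have K: "K \<in> carrier_mat ?n ?n" using W H W' by (simp add: K_def)
    have Kadj: "mat_adjoint K = K"
      using W H W' herm
      by (simp add: K_def mat_adjoint_mult[of _ ?n ?n _ ?n] W'_def
          assoc_mult_mat[of _ ?n ?n _ ?n _ ?n])
    have K0: "K $$ (i, 0) = (if i = 0 then e else 0)" if i: "i < ?n" for i
    proof -
      have "col K 0 = W' *\<^sub>v (H *\<^sub>v col W 0)"
        using W H W' by (simp add: K_def assoc_mult_mat[of _ ?n ?n _ ?n _ ?n] col_mult2[of _ ?n ?n _ ?n] del: col_mult)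
      also have "H *\<^sub>v col W 0 = e \<cdot>\<^sub>v col W 0"
        using H v by (simp add: c mult_mat_vec[of _ ?n ?n] Hv smult_smult_assoc mult.commute)
      also have "W' *\<^sub>v (e \<cdot>\<^sub>v col W 0) = e \<cdot>\<^sub>v col (W' * W) 0"
        using W W' mult_mat_vec[OF W', of "col W 0" e]
        by (simp add: col_mult2[of _ ?n ?n _ ?n] carrier_vecI del: col_mult)
      also have "\<dots> = e \<cdot>\<^sub>v unit_vec ?n 0" by (simp add: WW1)
      finally have "col K 0 $ i = (e \<cdot>\<^sub>v unit_vec ?n 0) $ i" by simp
      thus ?thesis using K i by (auto simp: unit_vec_def)
    qed
    have K0': "K $$ (0, j) = (if j = 0 then e else 0)" if j: "j < ?n" for j
    proof (cases "j = 0")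
      case False
      have "K $$ (0, j) = conjugate (K $$ (j, 0))"
        using index_mat_adjoint[of 0 K j] K j by (simp add: Kadj)
      thus ?thesis using K0[OF j] False by simp
    qed (use K0[of 0] in auto)
    define L where "L = mat m m (\<lambda>(i, j). K $$ (Suc i, Suc j))"
    have L: "L \<in> carrier_mat m m" by (simp add: L_def)
    have "mat_adjoint L = L"
    proof (rule eq_matI)
      fix i j assume "i < dim_row L" "j < dim_col L"
      thus "mat_adjoint L $$ (i, j) = L $$ (i, j)"
        using K index_mat_adjoint[of "Suc i" K "Suc j"] by (simp add: L_def Kadj)
    qed (auto simp: L_def)
    from Suc.IH[OF L this] obtain U D where U: "U \<in> carrier_mat m m" and D: "D \<in> carrier_mat m m"
      and diag: "diagonal_mat D" and UU: "mat_adjoint U * U = 1\<^sub>m m" and LU: "L = U * D * mat_adjoint U"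
      by blast
    \<comment> \<open>\<open>B X Y\<close> is the direct sum of a 1-by-1 and an m-by-m block. It is
      multiplicative by \<open>Bm\<close>, so the diagonalization of the block \<open>L\<close>
      lifts to one of \<open>K\<close>.\<close>
    define B where "B X Y = four_block_mat X (0\<^sub>m 1 m) (0\<^sub>m m 1) Y" for X Y :: "complex mat"
    have Bc: "B X Y \<in> carrier_mat ?n ?n" if "X \<in> carrier_mat 1 1" "Y \<in> carrier_mat m m" for X Y
      using four_block_carrier_mat[OF that] by (simp add: B_def)
    have Bm: "B X Y * B X' Y' = B (X * X') (Y * Y')"
      if "X \<in> carrier_mat 1 1" "Y \<in> carrier_mat m m" "X' \<in> carrier_mat 1 1" "Y' \<in> carrier_mat m m" for X Y X' Y'
      unfolding B_def using that by (subst mult_four_block_mat) auto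
    define E where "E = mat 1 1 (\<lambda>_. e)"
    have E: "E \<in> carrier_mat 1 1" by (simp add: E_def)
    have KB: "K = B E L"
    proof (rule eq_matI)
      fix i j assume "i < dim_row (B E L)" "j < dim_col (B E L)"
      hence ij: "i < ?n" "j < ?n" using Bc[OF E L] by auto
      show "K $$ (i, j) = B E L $$ (i, j)"
        using ij K0[of i] K0'[of j] E L
        by (cases i; cases j) (auto simp: B_def E_def L_def index_mat_four_block)
    qed (use K Bc[OF E L] in auto)
    define V where "V = B (1\<^sub>m 1) U"
    have V: "V \<in> carrier_mat ?n ?n" using Bc U by (simp add: V_def)
    have V': "mat_adjoint V = B (1\<^sub>m 1) (mat_adjoint U)"
      using U by (simp add: V_def B_def mat_adjoint_four_block_diag)
    have VV: "mat_adjoint V * V = 1\<^sub>m ?n"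
      unfolding V' unfolding V_def using U by (subst Bm) (auto simp: UU B_def)
    have BD: "B E D \<in> carrier_mat ?n ?n" using Bc E D by simp
    have KV: "K = V * B E D * mat_adjoint V"
      unfolding V' unfolding V_def KB LU using U D E by (simp add: Bm)
    have "diagonal_mat (B E D)"
      using diag D E by (auto simp: diagonal_mat_def B_def index_mat_four_block)
    moreover have "mat_adjoint (W * V) * (W * V) = 1\<^sub>m ?n"
    proof -
      have "mat_adjoint (W * V) * (W * V) = mat_adjoint V * ((W' * W) * V)"
        using W V W' by (simp add: mat_adjoint_mult[of _ ?n ?n _ ?n] W'_def
          assoc_mult_mat[of _ ?n ?n _ ?n _ ?n])
      thus ?thesis using V VV by (simp add: WW1)
    qed
    moreover have "H = (W * V) * B E D * mat_adjoint (W * V)"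
    proof -
      define Y where "Y = mat_adjoint V"
      have Y: "Y \<in> carrier_mat ?n ?n" using V by (simp add: Y_def)
      have "mat_adjoint (W * V) = Y * W'"
        using W V by (simp add: mat_adjoint_mult[of _ ?n ?n _ ?n] W'_def Y_def)
      hence "(W * V) * B E D * mat_adjoint (W * V) = W * K * W'"
        using W V W' BD Y unfolding KV Y_def[symmetric]
        by (simp add: assoc_mult_mat[of _ ?n ?n _ ?n _ ?n])
      also have "\<dots> = (W * W') * H * (W * W')"
        using W W' H unfolding K_def by (simp add: assoc_mult_mat[of _ ?n ?n _ ?n _ ?n])
      also have "\<dots> = H" using H by (simp add: WW2)
      finally show ?thesis by simp
    qed
    ultimately show ?case using W V BD by (intro exI[of _ "W * V"] exI[of _ "B E D"]) auto
  qed
  thus thesis using that by blast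
qed

section \<open>Eigenvalue counts and the sign of the Hermitian form on subspaces\<close>

lemma underdetermined_nontrivial_solution:
  fixes M :: "'a :: field mat"
  assumes M: "M \<in> carrier_mat n m" and I: "finite I" "I \<subseteq> {..<n}" "card I < m"
  obtains v where "v \<in> carrier_vec m" "v \<noteq> 0\<^sub>v m" "\<And>i. i \<in> I \<Longrightarrow> (M *\<^sub>v v) $ i = 0"
proof -
  obtain xs where xs: "set xs = I" "distinct xs" using finite_distinct_list[OF I(1)] by blast
  hence len: "length xs < m" using I(3) by (metis distinct_card)
  \<comment> \<open>The equations with index in \<open>I\<close> become the first rows of a square
    matrix, padded with zero rows. As \<open>card I < m\<close>, the last row is zero, so
    \<open>N\<close> is singular.\<close>
  define N where "N = mat m m (\<lambda>(r, j). if r < length xs then M $$ (xs ! r, j) else 0)"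
  have N: "N \<in> carrier_mat m m" by (simp add: N_def)
  let ?e = "unit_vec m (m - 1) :: 'a vec"
  have "transpose_mat N *\<^sub>v ?e = 0\<^sub>v m"
    using len by (intro eq_vecI) (auto simp: N_def)
  moreover have "?e \<noteq> 0\<^sub>v m"
  proof
    assume "?e = 0\<^sub>v m"
    hence "?e $ (m - 1) = 0\<^sub>v m $ (m - 1)" by simp
    thus False using len by simp
  qed
  ultimately have "det (transpose_mat N) = 0"
    using det_0_iff_vec_prod_zero_field[of "transpose_mat N" m] N unit_vec_carrier[of m "m - 1"]
    by (metis transpose_carrier_mat)
  hence "det N = 0" using det_transpose[OF N] by simp
  then obtain v where v: "v \<in> carrier_vec m" "v \<noteq> 0\<^sub>v m" and Nv: "N *\<^sub>v v = 0\<^sub>v m"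
    using det_0_iff_vec_prod_zero_field[OF N] by auto
  have "(M *\<^sub>v v) $ i = 0" if i: "i \<in> I" for i
  proof -
    from i xs(1) obtain r where r: "r < length xs" "xs ! r = i" by (metis in_set_conv_nth)
    have "(M *\<^sub>v v) $ i = (N *\<^sub>v v) $ r"
      using r len i I(2) M v(1) by (auto simp: N_def scalar_prod_def intro!: sum.cong)
    thus ?thesis using r len by (simp add: Nv)
  qed
  thus thesis using that v by blast
qed

lemma order_prod_linear_factors:
  fixes as :: "'a :: idom list"
  shows "Polynomial.order x (\<Prod>a\<leftarrow>as. [:- a, 1:]) = count_list as x"
proof (induction as)
  case (Cons a as)
  have nz: "(\<Prod>b\<leftarrow>bs. [:- b, 1:]) \<noteq> 0" for bs :: "'a list" by (auto simp: prod_list_zero_iff)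
  have "Polynomial.order x (\<Prod>b\<leftarrow>a # as. [:- b, 1:]) = Polynomial.order x [:- a, 1:] + count_list as x"
    using nz[of "a # as"] unfolding Cons[symmetric] list.map prod_list.Cons by (rule order_mult)
  thus ?case by (simp add: order_linear')
qed simp

text \<open>Similarity preserves the characteristic polynomial, so the multiplicity of an eigenvalue
  is the number of its occurrences on the diagonal of \<open>D\<close>. Adding these over the
  distinct nonnegative values counts diagonal positions.\<close>

lemma num_nonneg_eigenvalues_diagonalization:
  fixes H :: "complex mat"
  assumes U: "U \<in> carrier_mat n n" and D: "D \<in> carrier_mat n n" "diagonal_mat D"
    and UU: "mat_adjoint U * U = 1\<^sub>m n" and HU: "H = U * D * mat_adjoint U"
    and real: "\<And>i. i < n \<Longrightarrow> D $$ (i, i) \<in> \<real>"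
  shows "num_nonneg_eigenvalues H = card {i. i < n \<and> Re (D $$ (i, i)) \<ge> 0}"
proof -
  have H: "H \<in> carrier_mat n n" using U D by (auto simp: HU)
  have "similar_mat_wit H D U (mat_adjoint U)"
    using UU mat_mult_left_right_inverse[OF _ U UU] U D(1) H HU
    by (intro similar_mat_witI[of _ _ n]) auto
  hence "char_poly H = char_poly D" by (intro char_poly_similar) (auto simp: similar_mat_def)
  also have "\<dots> = (\<Prod>a\<leftarrow>diag_mat D. [:- a, 1:])"
    using D by (intro char_poly_upper_triangular[of _ n]) (auto simp: diagonal_mat_def upper_triangular_def)
  finally have cp: "char_poly H = (\<Prod>a\<leftarrow>diag_mat D. [:- a, 1:])" .
  have spec: "spectrum H = set (diag_mat D)"
    by (auto simp: spectrum_root_char_poly[OF H] cp poly_prod_list prod_list_zero_iff)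
  have ord: "Polynomial.order x (char_poly H) = count_list (diag_mat D) x" for x
    unfolding cp order_prod_linear_factors ..
  define xs where "xs = diag_mat D"
  define P where "P = (\<lambda>x :: complex. x \<in> \<real> \<and> Re x \<ge> 0)"
  have "num_nonneg_eigenvalues H = (\<Sum>x\<in>set (filter P xs). count_list (filter P xs) x)"
    unfolding num_nonneg_eigenvalues_def spec ord xs_def[symmetric]
    by (intro sum.cong) (auto simp: P_def count_list_eq_length_filter intro!: arg_cong[where f = length] filter_cong)
  also have "\<dots> = length (filter P xs)" by (rule sum_count_set) auto
  also have "\<dots> = card {i. i < length xs \<and> P (xs ! i)}" by (rule length_filter_conv_card)
  also have "{i. i < length xs \<and> P (xs ! i)} = {i. i < n \<and> Re (D $$ (i, i)) \<ge> 0}"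
    using D(1) real by (auto simp: xs_def diag_mat_def P_def)
  finally show ?thesis .
qed

lemma cscalar_prod_diagonalization:
  fixes H :: "complex mat"
  assumes U: "U \<in> carrier_mat n n" and D: "D \<in> carrier_mat n n" "diagonal_mat D"
    and HU: "H = U * D * mat_adjoint U"
    and real: "\<And>i. i < n \<Longrightarrow> D $$ (i, i) \<in> \<real>"
    and x: "x \<in> carrier_vec n"
  shows "(H *\<^sub>v x) \<bullet>c x = of_real (\<Sum>i<n. Re (D $$ (i, i)) * (cmod ((mat_adjoint U *\<^sub>v x) $ i))\<^sup>2)"
proof -
  define y where "y = mat_adjoint U *\<^sub>v x"
  have U': "mat_adjoint U \<in> carrier_mat n n" using U by simp
  have y: "y \<in> carrier_vec n" using mult_mat_vec_carrier[OF U' x] by (simp add: y_def)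
  have Dy: "D *\<^sub>v y \<in> carrier_vec n" using mult_mat_vec_carrier[OF D(1) y] .
  have "H *\<^sub>v x = U *\<^sub>v (D *\<^sub>v y)"
    using U U' D(1) x y by (simp add: HU y_def[symmetric] assoc_mult_mat_vec[of _ n n _ n]
        assoc_mult_mat_vec[OF mult_carrier_mat[OF U D(1)] U' x])
  hence "(H *\<^sub>v x) \<bullet>c x = (D *\<^sub>v y) \<bullet>c y"
    using cscalar_prod_mat_adjoint[OF U Dy x] by (simp add: y_def)
  also have "\<dots> = (\<Sum>i<n. (D *\<^sub>v y) $ i * cnj (y $ i))"
    using y by (simp add: scalar_prod_def atLeast0LessThan)
  also have "\<dots> = (\<Sum>i<n. of_real (Re (D $$ (i, i)) * (cmod (y $ i))\<^sup>2))"
  proof (rule sum.cong)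
    fix i assume "i \<in> {..<n}"
    hence i: "i < n" by simp
    have "(D *\<^sub>v y) $ i = (\<Sum>j<n. D $$ (i, j) * y $ j)"
      using i D y by (simp add: scalar_prod_def atLeast0LessThan)
    also have "\<dots> = (\<Sum>j<n. if j = i then D $$ (i, i) * y $ i else 0)"
      using i D by (intro sum.cong) (auto simp: diagonal_mat_def)
    finally have Dyi: "(D *\<^sub>v y) $ i = D $$ (i, i) * y $ i" using i by simp
    have "complex_of_real (Re (D $$ (i, i))) = D $$ (i, i)"
      using real[OF i] by (simp add: complex_is_Real_iff complex_eq_iff)
    thus "(D *\<^sub>v y) $ i * cnj (y $ i) = of_real (Re (D $$ (i, i)) * (cmod (y $ i))\<^sup>2)"
      unfolding of_real_mult complex_norm_square Dyi by simp
  qed simp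
  finally show ?thesis by (simp add: y_def)
qed

text \<open>Solving for \<open>D\<close> exhibits it as a unitary conjugate of \<open>H\<close>,
  hence Hermitian, so its diagonal entries are fixed by conjugation.\<close>

lemma diagonalization_real:
  fixes H :: "complex mat"
  assumes U: "U \<in> carrier_mat n n" and D: "D \<in> carrier_mat n n"
    and UU: "mat_adjoint U * U = 1\<^sub>m n" and HU: "H = U * D * mat_adjoint U"
    and herm: "mat_adjoint H = H" and i: "i < n"
  shows "D $$ (i, i) \<in> \<real>"
proof -
  define U' where "U' = mat_adjoint U"
  have U': "U' \<in> carrier_mat n n" "U' * U = 1\<^sub>m n" using U UU by (simp_all add: U'_def)
  have "U' * H * U = (U' * U) * D * (U' * U)"
    using U U'(1) D by (simp add: HU U'_def[symmetric] assoc_mult_mat[of _ n n _ n _ n])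
  hence DH: "D = U' * H * U" using D by (simp add: U')
  have H: "H \<in> carrier_mat n n" using U D by (auto simp: HU)
  have "mat_adjoint D = D"
    unfolding DH using U U' H herm
    by (simp add: mat_adjoint_mult[of _ n n _ n] U'_def assoc_mult_mat[of _ n n _ n _ n])
  hence "cnj (D $$ (i, i)) = D $$ (i, i)"
    using index_mat_adjoint[of i D i] D i by simp
  thus ?thesis by (simp add: Reals_cnj_iff)
qed

text \<open>If the bound failed, fewer than \<open>m\<close> eigenvalues would be negative, and some
  nonzero \<open>v\<close> would give a vector \<open>S v\<close> without components along their
  eigenvectors. There the form is both nonnegative and nonpositive, so it vanishes term by term and
  \<open>H\<close> annihilates \<open>S v\<close>. Asking for a nonpositive form and injectivity of
  \<open>H\<close> on the range, not for a negative definite form, lets isotropic subspaces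
  qualify.\<close>

lemma num_nonneg_eigenvalues_upper:
  fixes H S :: "complex mat"
  assumes H: "H \<in> carrier_mat n n" "mat_adjoint H = H" and S: "S \<in> carrier_mat n m"
    and le: "\<And>v. v \<in> carrier_vec m \<Longrightarrow> Re ((H *\<^sub>v (S *\<^sub>v v)) \<bullet>c (S *\<^sub>v v)) \<le> 0"
    and inj: "\<And>v. v \<in> carrier_vec m \<Longrightarrow> H *\<^sub>v (S *\<^sub>v v) = 0\<^sub>v n \<Longrightarrow> v = 0\<^sub>v m"
  shows "num_nonneg_eigenvalues H + m \<le> n"
proof (rule ccontr)
  assume contr: "\<not> ?thesis"
  obtain U D where UD: "U \<in> carrier_mat n n" "D \<in> carrier_mat n n" "diagonal_mat D"
    "mat_adjoint U * U = 1\<^sub>m n" "H = U * D * mat_adjoint U"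
    by (rule hermitian_diagonalization[OF H])
  note real = diagonalization_real[OF UD(1,2,4,5) H(2)]
  define J where "J = {i. i < n \<and> Re (D $$ (i, i)) \<ge> 0}"
  \<comment> \<open>These are the positions of the strictly negative eigenvalues.\<close>
  define I where "I = {..<n} - J"
  have "card J = num_nonneg_eigenvalues H"
    unfolding J_def by (rule num_nonneg_eigenvalues_diagonalization[OF UD real, symmetric])
  moreover have "card I = n - card J"
    unfolding I_def by (subst card_Diff_subset) (auto simp: J_def)
  moreover have "card J \<le> n" using card_mono[of "{..<n}" J] by (auto simp: J_def)
  ultimately have card: "card I < m" using contr by simp
  have U': "mat_adjoint U \<in> carrier_mat n n" using UD by simp
  obtain v where v: "v \<in> carrier_vec m" "v \<noteq> 0\<^sub>v m"
    and vI: "\<And>i. i \<in> I \<Longrightarrow> (mat_adjoint U * S *\<^sub>v v) $ i = 0"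
    by (rule underdetermined_nontrivial_solution[of "mat_adjoint U * S" n m I])
       (use U' S card in \<open>auto simp: I_def\<close>)
  define x where "x = S *\<^sub>v v"
  define y where "y = mat_adjoint U *\<^sub>v x"
  have x: "x \<in> carrier_vec n" using mult_mat_vec_carrier[OF S v(1)] by (simp add: x_def)
  have y: "y \<in> carrier_vec n" using mult_mat_vec_carrier[OF U' x] by (simp add: y_def)
  have yI: "y $ i = 0" if "i \<in> I" for i
    using vI[OF that] assoc_mult_mat_vec[OF U' S v(1)] by (simp add: y_def x_def)
  define t where "t i = Re (D $$ (i, i)) * (cmod (y $ i))\<^sup>2" for i
  have t: "t i \<ge> 0" if "i < n" for i
    using that yI[of i] by (cases "i \<in> I") (auto simp: t_def I_def J_def)
  have "(H *\<^sub>v x) \<bullet>c x = of_real (\<Sum>i<n. t i)"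
    unfolding t_def y_def by (rule cscalar_prod_diagonalization[OF UD(1,2,3,5) real x])
  hence "Re ((H *\<^sub>v x) \<bullet>c x) = (\<Sum>i<n. t i)" by simp
  hence "(\<Sum>i<n. t i) \<le> 0" using le[OF v(1)] by (simp add: x_def)
  moreover have "(\<Sum>i<n. t i) \<ge> 0" using t by (intro sum_nonneg) auto
  ultimately have "(\<Sum>i<n. t i) = 0" by simp
  hence t0: "t i = 0" if "i < n" for i using t that by (subst (asm) sum_nonneg_eq_0_iff) auto
  \<comment> \<open>Each term \<open>t i\<close> is zero, so for every \<open>i\<close> the
    eigenvalue or the coordinate of \<open>y\<close> is zero, and their product vanishes.\<close>
  have "D *\<^sub>v y = 0\<^sub>v n"
  proof (rule eq_vecI)
    fix i assume "i < dim_vec (0\<^sub>v n :: complex vec)"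
    hence i: "i < n" by simp
    have "D $$ (i, j) * y $ j = 0" if j: "j < n" for j
    proof (cases "j = i")
      case True
      have "complex_of_real (Re (D $$ (i, i))) = D $$ (i, i)"
        using real[OF i] by (simp add: complex_is_Real_iff complex_eq_iff)
      thus ?thesis using t0[OF i] True by (metis t_def mult_eq_0_iff norm_eq_zero of_real_0 zero_eq_power2)
    qed (use UD i j in \<open>auto simp: diagonal_mat_def\<close>)
    thus "(D *\<^sub>v y) $ i = 0\<^sub>v n $ i"
      using i UD(2) y by (auto simp: scalar_prod_def intro!: sum.neutral)
  qed (use UD in auto)
  moreover have "H *\<^sub>v x = U *\<^sub>v (D *\<^sub>v y)"
    using UD(1,2) U' x y by (simp add: UD(5) y_def[symmetric] assoc_mult_mat_vec[of _ n n _ n]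
        assoc_mult_mat_vec[OF mult_carrier_mat[OF UD(1,2)] U' x])
  ultimately have "H *\<^sub>v x = 0\<^sub>v n" using UD(1) by (intro eq_vecI) auto
  thus False using inj[OF v(1)] v(2) by (simp add: x_def)
qed

text \<open>Otherwise some nonzero \<open>v\<close> would give a vector \<open>S v\<close> supported
  on eigenvectors with negative eigenvalues. A nonnegative form there forces every coordinate to
  vanish, because these eigenvalues are strictly negative, so \<open>S v\<close> itself is
  zero.\<close>

lemma num_nonneg_eigenvalues_lower:
  fixes H S :: "complex mat"
  assumes H: "H \<in> carrier_mat n n" "mat_adjoint H = H" and S: "S \<in> carrier_mat n m"
    and ge: "\<And>v. v \<in> carrier_vec m \<Longrightarrow> Re ((H *\<^sub>v (S *\<^sub>v v)) \<bullet>c (S *\<^sub>v v)) \<ge> 0"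
    and inj: "\<And>v. v \<in> carrier_vec m \<Longrightarrow> S *\<^sub>v v = 0\<^sub>v n \<Longrightarrow> v = 0\<^sub>v m"
  shows "m \<le> num_nonneg_eigenvalues H"
proof (rule ccontr)
  assume contr: "\<not> ?thesis"
  obtain U D where UD: "U \<in> carrier_mat n n" "D \<in> carrier_mat n n" "diagonal_mat D"
    "mat_adjoint U * U = 1\<^sub>m n" "H = U * D * mat_adjoint U"
    by (rule hermitian_diagonalization[OF H])
  note real = diagonalization_real[OF UD(1,2,4,5) H(2)]
  define I where "I = {i. i < n \<and> Re (D $$ (i, i)) \<ge> 0}"
  have "card I = num_nonneg_eigenvalues H"
    unfolding I_def by (rule num_nonneg_eigenvalues_diagonalization[OF UD real, symmetric])
  hence card: "card I < m" using contr by simp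
  have U': "mat_adjoint U \<in> carrier_mat n n" using UD by simp
  obtain v where v: "v \<in> carrier_vec m" "v \<noteq> 0\<^sub>v m"
    and vI: "\<And>i. i \<in> I \<Longrightarrow> (mat_adjoint U * S *\<^sub>v v) $ i = 0"
    by (rule underdetermined_nontrivial_solution[of "mat_adjoint U * S" n m I])
       (use U' S card in \<open>auto simp: I_def\<close>)
  define x where "x = S *\<^sub>v v"
  define y where "y = mat_adjoint U *\<^sub>v x"
  have x: "x \<in> carrier_vec n" using mult_mat_vec_carrier[OF S v(1)] by (simp add: x_def)
  have y: "y \<in> carrier_vec n" using mult_mat_vec_carrier[OF U' x] by (simp add: y_def)
  have yI: "y $ i = 0" if "i \<in> I" for i
    using vI[OF that] assoc_mult_mat_vec[OF U' S v(1)] by (simp add: y_def x_def)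
  define t where "t i = Re (D $$ (i, i)) * (cmod (y $ i))\<^sup>2" for i
  have t: "t i \<le> 0" if "i < n" for i
    using that yI[of i] by (cases "i \<in> I") (auto simp: t_def I_def mult_nonpos_nonneg)
  have "(H *\<^sub>v x) \<bullet>c x = of_real (\<Sum>i<n. t i)"
    unfolding t_def y_def by (rule cscalar_prod_diagonalization[OF UD(1,2,3,5) real x])
  hence "Re ((H *\<^sub>v x) \<bullet>c x) = (\<Sum>i<n. t i)" by simp
  hence "(\<Sum>i<n. - t i) \<le> 0" using ge[OF v(1)] by (simp add: x_def sum_negf)
  moreover have "(\<Sum>i<n. - t i) \<ge> 0" using t by (intro sum_nonneg) auto
  ultimately have "(\<Sum>i<n. - t i) = 0" by linarith
  hence t0: "t i = 0" if "i < n" for i using t that by (subst (asm) sum_nonneg_eq_0_iff) auto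
  have "y $ i = 0" if "i < n" for i
    using t0[OF that] yI[of i] that by (cases "i \<in> I") (auto simp: t_def I_def)
  hence "y = 0\<^sub>v n" using y by (intro eq_vecI) auto
  moreover have "U *\<^sub>v y = x"
    using assoc_mult_mat_vec[OF UD(1) U' x] mat_mult_left_right_inverse[OF U' UD(1,4)] x
    by (simp add: y_def)
  ultimately have "x = 0\<^sub>v n" using UD(1) by (intro eq_vecI) auto
  thus False using inj[OF v(1)] v(2) by (simp add: x_def)
qed

section \<open>Hermitian parts and zero-dilation subspaces\<close>

lemma smult_mat_mult_vec:
  fixes A :: "'a :: comm_semiring_0 mat"
  assumes "A \<in> carrier_mat n m" "x \<in> carrier_vec m"
  shows "(c \<cdot>\<^sub>m A) *\<^sub>v x = c \<cdot>\<^sub>v (A *\<^sub>v x)"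
  using assms by (intro eq_vecI) (auto simp: smult_scalar_prod_distrib[of _ m])

lemma re_part_carrier[simp]: "B \<in> carrier_mat n n \<Longrightarrow> re_part B \<in> carrier_mat n n"
  by (simp add: re_part_def)

lemma mat_adjoint_re_part:
  assumes "B \<in> carrier_mat n n"
  shows "mat_adjoint (re_part B) = re_part B"
  using assms by (intro eq_matI) (auto simp: re_part_def add.commute)

lemma re_part_mult_vec:
  assumes "B \<in> carrier_mat n n" "x \<in> carrier_vec n"
  shows "re_part B *\<^sub>v x = (1 / 2) \<cdot>\<^sub>v (B *\<^sub>v x + mat_adjoint B *\<^sub>v x)"
  using assms add_mult_distrib_mat_vec[OF assms(1) mat_adjoint_carrier[OF assms(1)] assms(2)]
    smult_mat_mult_vec[OF add_carrier_mat[OF mat_adjoint_carrier[OF assms(1)]] assms(2)]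
  by (simp add: re_part_def)

lemma Re_cscalar_prod_re_part:
  assumes B: "B \<in> carrier_mat n n" and x: "x \<in> carrier_vec n"
  shows "Re ((re_part B *\<^sub>v x) \<bullet>c x) = Re ((B *\<^sub>v x) \<bullet>c x)"
proof -
  have Bx: "B *\<^sub>v x \<in> carrier_vec n" and Bax: "mat_adjoint B *\<^sub>v x \<in> carrier_vec n"
    using mult_mat_vec_carrier[OF B x] mult_mat_vec_carrier[OF mat_adjoint_carrier[OF B] x] .
  have "(mat_adjoint B *\<^sub>v x) \<bullet>c x = x \<bullet>c (B *\<^sub>v x)"
    using cscalar_prod_mat_adjoint[of "mat_adjoint B" n n x x] B x by simp
  also have "\<dots> = cnj ((B *\<^sub>v x) \<bullet>c x)"
    using carrier_vecD[OF Bx] carrier_vecD[OF x]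
    by (simp add: scalar_prod_def mult.commute del: index_mult_mat_vec dim_mult_mat_vec)
  finally have *: "(mat_adjoint B *\<^sub>v x) \<bullet>c x = cnj ((B *\<^sub>v x) \<bullet>c x)" .
  have eq: "(re_part B *\<^sub>v x) \<bullet>c x = 1 / 2 * ((B *\<^sub>v x) \<bullet>c x + (mat_adjoint B *\<^sub>v x) \<bullet>c x)"
    using Bx Bax x unfolding re_part_mult_vec[OF B x]
    by (simp add: smult_scalar_prod_distrib[of _ n] add_scalar_prod_distrib[of _ n])
  show ?thesis unfolding eq * by simp
qed

text \<open>Moving \<open>V\<close> across the inner product turns the form of \<open>A\<close> on
  its range into that of the zero matrix, and a scalar factor comes out. Hence one \<open>V\<close>
  serves all rotations of \<open>A\<close> at once.\<close>

lemma zero_dilation_isotropic: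
  assumes A: "A \<in> carrier_mat n n" and zd: "zero_dilation A k"
  obtains V where "V \<in> carrier_mat n k"
    "\<And>v. v \<in> carrier_vec k \<Longrightarrow> V *\<^sub>v v = 0\<^sub>v n \<Longrightarrow> v = 0\<^sub>v k"
    "\<And>v c. v \<in> carrier_vec k \<Longrightarrow> Re ((re_part (c \<cdot>\<^sub>m A) *\<^sub>v (V *\<^sub>v v)) \<bullet>c (V *\<^sub>v v)) = 0"
proof -
  from zd A obtain V where V: "V \<in> carrier_mat n k" and VV: "mat_adjoint V * V = 1\<^sub>m k"
    and VAV: "mat_adjoint V * A * V = 0\<^sub>m k k"
    by (auto simp: zero_dilation_def)
  have V': "mat_adjoint V \<in> carrier_mat k n" using V by simp
  show thesis
  proof (rule that[OF V])
    fix v :: "complex vec" assume v: "v \<in> carrier_vec k"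
    show "v = 0\<^sub>v k" if "V *\<^sub>v v = 0\<^sub>v n"
    proof -
      have "v = mat_adjoint V *\<^sub>v (V *\<^sub>v v)"
        using assoc_mult_mat_vec[OF V' V v] v by (simp add: VV)
      also have "\<dots> = 0\<^sub>v k" unfolding that using V by (intro eq_vecI) auto
      finally show ?thesis .
    qed
    fix c :: complex
    have cA: "c \<cdot>\<^sub>m A \<in> carrier_mat n n" using A by simp
    have Vv: "V *\<^sub>v v \<in> carrier_vec n" using mult_mat_vec_carrier[OF V v] .
    have AVv: "A *\<^sub>v (V *\<^sub>v v) \<in> carrier_vec n" using mult_mat_vec_carrier[OF A Vv] .
    have "(A *\<^sub>v (V *\<^sub>v v)) \<bullet>c (V *\<^sub>v v) = (mat_adjoint V *\<^sub>v (A *\<^sub>v (V *\<^sub>v v))) \<bullet>c v"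
      using cscalar_prod_mat_adjoint[OF V' AVv v] by simp
    also have "mat_adjoint V *\<^sub>v (A *\<^sub>v (V *\<^sub>v v)) = 0\<^sub>m k k *\<^sub>v v"
      unfolding VAV[symmetric]
      using assoc_mult_mat_vec[OF V' A Vv] assoc_mult_mat_vec[OF mult_carrier_mat[OF V' A] V v] by simp
    also have "(0\<^sub>m k k *\<^sub>v v) \<bullet>c v = 0" using v by (simp add: scalar_prod_def)
    finally have *: "(A *\<^sub>v (V *\<^sub>v v)) \<bullet>c (V *\<^sub>v v) = 0" .
    have "c \<cdot>\<^sub>m A *\<^sub>v (V *\<^sub>v v) = c \<cdot>\<^sub>v (A *\<^sub>v (V *\<^sub>v v))"
      by (rule smult_mat_mult_vec[OF A Vv])
    hence "(c \<cdot>\<^sub>m A *\<^sub>v (V *\<^sub>v v)) \<bullet>c (V *\<^sub>v v) = 0"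
      using AVv Vv * by (simp add: smult_scalar_prod_distrib[of _ n])
    thus "Re ((re_part (c \<cdot>\<^sub>m A) *\<^sub>v (V *\<^sub>v v)) \<bullet>c (V *\<^sub>v v)) = 0"
      by (simp add: Re_cscalar_prod_re_part[OF cA Vv])
  qed
qed

text \<open>On an isotropic subspace the form is in particular nonnegative. Any single
  \<open>c\<close> therefore bounds the zero-dilation index from above.\<close>

lemma zero_dilation_le_num_nonneg:
  assumes A: "A \<in> carrier_mat n n" and zd: "zero_dilation A k"
  shows "k \<le> num_nonneg_eigenvalues (re_part (c \<cdot>\<^sub>m A))"
proof -
  have cA: "c \<cdot>\<^sub>m A \<in> carrier_mat n n" using A by simp
  from zero_dilation_isotropic[OF A zd] obtain V where V: "V \<in> carrier_mat n k"
    and *: "\<And>v. v \<in> carrier_vec k \<Longrightarrow> V *\<^sub>v v = 0\<^sub>v n \<Longrightarrow> v = 0\<^sub>v k"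
    "\<And>v c. v \<in> carrier_vec k \<Longrightarrow> Re ((re_part (c \<cdot>\<^sub>m A) *\<^sub>v (V *\<^sub>v v)) \<bullet>c (V *\<^sub>v v)) = 0"
    by metis
  show ?thesis
    by (rule num_nonneg_eigenvalues_lower[OF re_part_carrier[OF cA] mat_adjoint_re_part[OF cA] V])
       (simp_all add: *)
qed

text \<open>An isotropic subspace also has a nonpositive form, and a nonsingular Hermitian part is
  injective on it.\<close>

lemma num_nonneg_le_of_zero_dilation:
  assumes A: "A \<in> carrier_mat n n" and zd: "zero_dilation A k"
    and inj: "\<And>x. x \<in> carrier_vec n \<Longrightarrow> re_part (c \<cdot>\<^sub>m A) *\<^sub>v x = 0\<^sub>v n \<Longrightarrow> x = 0\<^sub>v n"
  shows "num_nonneg_eigenvalues (re_part (c \<cdot>\<^sub>m A)) + k \<le> n"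
proof -
  have cA: "c \<cdot>\<^sub>m A \<in> carrier_mat n n" using A by simp
  from zero_dilation_isotropic[OF A zd] obtain V where V: "V \<in> carrier_mat n k"
    and *: "\<And>v. v \<in> carrier_vec k \<Longrightarrow> V *\<^sub>v v = 0\<^sub>v n \<Longrightarrow> v = 0\<^sub>v k"
    "\<And>v c. v \<in> carrier_vec k \<Longrightarrow> Re ((re_part (c \<cdot>\<^sub>m A) *\<^sub>v (V *\<^sub>v v)) \<bullet>c (V *\<^sub>v v)) = 0"
    by metis
  show ?thesis
    by (rule num_nonneg_eigenvalues_upper[OF re_part_carrier[OF cA] mat_adjoint_re_part[OF cA] V])
       (use * inj mult_mat_vec_carrier[OF V] in auto)
qed

subsection \<open>Weighted cyclic matrices\<close>

lemma weighted_cyclic_carrier[simp]: "weighted_cyclic_mat n w \<in> carrier_mat n n"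
  by (simp add: weighted_cyclic_mat_def)

lemma dim_weighted_cyclic[simp]:
  "dim_row (weighted_cyclic_mat n w) = n" "dim_col (weighted_cyclic_mat n w) = n"
  by (simp_all add: weighted_cyclic_mat_def)

lemma smult_weighted_cyclic_mat:
  "c \<cdot>\<^sub>m weighted_cyclic_mat n w = weighted_cyclic_mat n (\<lambda>j. c * w j)"
  by (intro eq_matI) (auto simp: weighted_cyclic_mat_def)

lemma weighted_cyclic_mult_vec:
  assumes "x \<in> carrier_vec n" "i < n"
  shows "(weighted_cyclic_mat n w *\<^sub>v x) $ i =
    (if i + 1 < n then w (i + 1) * x $ (i + 1) else w n * x $ 0)"
proof -
  have "(weighted_cyclic_mat n w *\<^sub>v x) $ i = (\<Sum>j<n. weighted_cyclic_mat n w $$ (i, j) * x $ j)"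
    using assms by (simp add: weighted_cyclic_mat_def scalar_prod_def atLeast0LessThan)
  also have "\<dots> = (\<Sum>j<n. if j = (if i + 1 < n then i + 1 else 0)
    then (if i + 1 < n then w (i + 1) * x $ (i + 1) else w n * x $ 0) else 0)"
    using assms by (intro sum.cong) (auto simp: weighted_cyclic_mat_def)
  finally show ?thesis using assms by simp
qed

lemma adjoint_weighted_cyclic_mult_vec:
  assumes "x \<in> carrier_vec n" "i < n" "n \<ge> 2"
  shows "(mat_adjoint (weighted_cyclic_mat n w) *\<^sub>v x) $ i =
    (if i = 0 then cnj (w n) * x $ (n - 1) else cnj (w i) * x $ (i - 1))"
proof -
  have "(mat_adjoint (weighted_cyclic_mat n w) *\<^sub>v x) $ i
      = (\<Sum>j<n. cnj (weighted_cyclic_mat n w $$ (j, i)) * x $ j)"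
    using assms by (simp add: weighted_cyclic_mat_def scalar_prod_def atLeast0LessThan)
  also have "\<dots> = (\<Sum>j<n. if j = (if i = 0 then n - 1 else i - 1)
    then (if i = 0 then cnj (w n) * x $ (n - 1) else cnj (w i) * x $ (i - 1)) else 0)"
    using assms by (intro sum.cong) (auto simp: weighted_cyclic_mat_def)
  also have "\<dots> = (if i = 0 then cnj (w n) * x $ (n - 1) else cnj (w i) * x $ (i - 1))"
    using assms by (subst sum.delta) auto
  finally show ?thesis .
qed

lemma zero_dilation_weighted_cyclic: "zero_dilation (weighted_cyclic_mat n w) (n div 2)"
proof -
  define V :: "complex mat" where "V = mat n (n div 2) (\<lambda>(i, j). if i = 2 * j then 1 else 0)"
  have V: "V \<in> carrier_mat n (n div 2)" by (simp add: V_def)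
  \<comment> \<open>The columns of \<open>V\<close> are e_0, e_2, e_4, ..., so multiplying by its
    adjoint on the left, or by \<open>V\<close> on the right, selects rows or columns of even
    index.\<close>
  have VM: "(mat_adjoint V * M) $$ (i, j) = M $$ (2 * i, j)"
    if "M \<in> carrier_mat n k" "i < n div 2" "j < k" for M i j k
  proof -
    have "(mat_adjoint V * M) $$ (i, j) = (\<Sum>l<n. cnj (if l = 2 * i then 1 else 0) * M $$ (l, j))"
      using that by (simp add: V_def scalar_prod_def atLeast0LessThan)
    also have "\<dots> = (\<Sum>l<n. if l = 2 * i then M $$ (2 * i, j) else 0)"
      by (intro sum.cong) auto
    finally show ?thesis using that by simp
  qed
  have MV: "(M * V) $$ (i, j) = M $$ (i, 2 * j)"
    if "M \<in> carrier_mat k n" "i < k" "j < n div 2" for M i j k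
  proof -
    have "(M * V) $$ (i, j) = (\<Sum>l<n. M $$ (i, l) * (if l = 2 * j then 1 else 0))"
      using that by (simp add: V_def scalar_prod_def atLeast0LessThan)
    also have "\<dots> = (\<Sum>l<n. if l = 2 * j then M $$ (i, 2 * j) else 0)"
      by (intro sum.cong) auto
    finally show ?thesis using that by simp
  qed
  let ?A = "weighted_cyclic_mat n w"
  have A: "?A \<in> carrier_mat n n" by simp
  have "mat_adjoint V * V = 1\<^sub>m (n div 2)"
  proof (rule eq_matI)
    fix i j assume "i < dim_row (1\<^sub>m (n div 2) :: complex mat)"
      "j < dim_col (1\<^sub>m (n div 2) :: complex mat)"
    hence ij: "i < n div 2" "j < n div 2" by auto
    show "(mat_adjoint V * V) $$ (i, j) = 1\<^sub>m (n div 2) $$ (i, j)"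
      unfolding VM[OF V ij] using ij by (auto simp: V_def)
  qed (use V in auto)
  moreover have "mat_adjoint V * ?A * V = 0\<^sub>m (n div 2) (n div 2)"
  proof (rule eq_matI)
    fix i j assume "i < dim_row (0\<^sub>m (n div 2) (n div 2) :: complex mat)"
      "j < dim_col (0\<^sub>m (n div 2) (n div 2) :: complex mat)"
    hence ij: "i < n div 2" "j < n div 2" by auto
    have "(mat_adjoint V * ?A * V) $$ (i, j) = ?A $$ (2 * i, 2 * j)"
      using MV[OF mult_carrier_mat[OF mat_adjoint_carrier[OF V] A] ij] VM[OF A ij(1), of "2 * j"] ij
      by simp
    also have "\<dots> = 0"
    proof -
      \<comment> \<open>Parity excludes the superdiagonal. The corner lies in row n - 1, which is
        even for odd n, but i < n div 2 keeps 2 i at most n - 2.\<close>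
      have "2 * j \<noteq> 2 * i + 1" by presburger
      moreover have "2 * i \<noteq> n - 1" "2 * i < n" "2 * j < n" using ij by linarith+
      ultimately show ?thesis by (simp add: weighted_cyclic_mat_def)
    qed
    finally show "(mat_adjoint V * ?A * V) $$ (i, j) = 0\<^sub>m (n div 2) (n div 2) $$ (i, j)"
      using ij by simp
  qed (use V in auto)
  ultimately show ?thesis using V A unfolding zero_dilation_def by (metis carrier_matD(1))
qed

section \<open>Even n: finitely many singular angles\<close>

lemma finite_exp_eq_in_interval: "finite {\<theta> \<in> {a..b}. (exp (- (\<i> * complex_of_real \<theta>)))\<^sup>2 = z}"
proof (cases "{\<theta> \<in> {a..b}. (exp (- (\<i> * complex_of_real \<theta>)))\<^sup>2 = z} = {}")
  case False
  then obtain t where t: "t \<in> {a..b}" "(exp (- (\<i> * complex_of_real t)))\<^sup>2 = z" by auto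
  \<comment> \<open>The squared exponential has period pi in \<theta>, so two solutions in the
    interval differ by m pi with |m| at most (b - a) / pi.\<close>
  define N where "N = \<lceil>(b - a) / pi\<rceil>"
  have "{\<theta> \<in> {a..b}. (exp (- (\<i> * complex_of_real \<theta>)))\<^sup>2 = z} \<subseteq> (\<lambda>m. t - of_int m * pi) ` {-N..N}"
  proof
    fix \<theta> assume "\<theta> \<in> {\<theta> \<in> {a..b}. (exp (- (\<i> * complex_of_real \<theta>)))\<^sup>2 = z}"
    hence th: "\<theta> \<in> {a..b}" "exp (2 * - (\<i> * complex_of_real \<theta>)) = exp (2 * - (\<i> * complex_of_real t))"
      using t unfolding exp_double by simp_all
    from th(2) obtain m :: int where
      "2 * - (\<i> * complex_of_real \<theta>) = 2 * - (\<i> * complex_of_real t) + of_int (2 * m) * pi * \<i>"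
      unfolding exp_eq by blast
    from arg_cong[OF this, of Im] have m: "\<theta> = t - of_int m * pi" by simp
    have "\<bar>of_int m * pi\<bar> \<le> b - a" using m th(1) t(1) by auto
    hence "\<bar>of_int m\<bar> \<le> (b - a) / pi" by (simp add: abs_mult field_simps)
    hence "real_of_int \<bar>m\<bar> \<le> real_of_int N"
      unfolding N_def using le_of_int_ceiling[of "(b - a) / pi"] by linarith
    hence "m \<in> {-N..N}" by (simp add: abs_le_iff)
    thus "\<theta> \<in> (\<lambda>m. t - of_int m * pi) ` {-N..N}" using m by blast
  qed
  thus ?thesis by (rule finite_subset) simp
qed (metis finite.emptyI)

lemma finite_singular_re_part:
  assumes A: "A \<in> carrier_mat n n"
    and inj: "\<And>x. x \<in> carrier_vec n \<Longrightarrow> A *\<^sub>v x = 0\<^sub>v n \<Longrightarrow> x = 0\<^sub>v n"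
  shows "finite {\<theta> \<in> {a..b}. \<exists>x \<in> carrier_vec n. x \<noteq> 0\<^sub>v n \<and>
    re_part (exp (- (\<i> * complex_of_real \<theta>)) \<cdot>\<^sub>m A) *\<^sub>v x = 0\<^sub>v n}" (is "finite ?S")
proof -
  have "det A \<noteq> 0" using det_0_iff_vec_prod_zero_field[OF A] inj by auto
  from det_non_zero_imp_unit[OF A this, of "()"] obtain A' where
    A': "A' \<in> carrier_mat n n" and AA: "A' * A = 1\<^sub>m n"
    by (auto simp: Units_def ring_mat_def)
  define B where "B = - (A' * mat_adjoint A)"
  have B: "B \<in> carrier_mat n n" using A' A by (simp add: B_def)
  have "?S \<subseteq> (\<Union>z\<in>spectrum B. {\<theta> \<in> {a..b}. (exp (- (\<i> * complex_of_real \<theta>)))\<^sup>2 = z})"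
  proof
    fix \<theta> assume "\<theta> \<in> ?S"
    define c where "c = exp (- (\<i> * complex_of_real \<theta>))"
    from \<open>\<theta> \<in> ?S\<close> obtain x where \<theta>: "\<theta> \<in> {a..b}" and x: "x \<in> carrier_vec n" "x \<noteq> 0\<^sub>v n"
      and 0: "re_part (c \<cdot>\<^sub>m A) *\<^sub>v x = 0\<^sub>v n" by (auto simp: c_def)
    have "cmod c = 1" by (simp add: c_def)
    hence cc: "c * cnj c = 1" using complex_norm_square[of c] by simp
    define y where "y = A *\<^sub>v x"
    define z where "z = mat_adjoint A *\<^sub>v x"
    have yz: "y \<in> carrier_vec n" "z \<in> carrier_vec n"
      using mult_mat_vec_carrier[OF A x(1)] mult_mat_vec_carrier[OF mat_adjoint_carrier[OF A] x(1)]
      by (simp_all add: y_def z_def)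
    have cA: "c \<cdot>\<^sub>m A \<in> carrier_mat n n" using A by simp
    have re: "re_part (c \<cdot>\<^sub>m A) *\<^sub>v x = (1 / 2) \<cdot>\<^sub>v (c \<cdot>\<^sub>v y + cnj c \<cdot>\<^sub>v z)"
      unfolding re_part_mult_vec[OF cA x(1)] mat_adjoint_smult smult_mat_mult_vec[OF A x(1)]
        smult_mat_mult_vec[OF mat_adjoint_carrier[OF A] x(1)] y_def z_def ..
    have "c\<^sup>2 \<cdot>\<^sub>v y = - z"
    proof (rule eq_vecI)
      fix i assume "i < dim_vec (- z)"
      hence i: "i < n" using yz by simp
      have "(re_part (c \<cdot>\<^sub>m A) *\<^sub>v x) $ i = (c * y $ i + cnj c * z $ i) / 2"
        using i yz by (simp add: re)
      hence "c * y $ i + cnj c * z $ i = 0" using 0 i by simp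
      \<comment> \<open>Since |c| = 1, multiplying by \<open>c\<close> turns the coefficient of
        \<open>z\<close> into 1 and leaves an eigenvalue equation for c^2 after \<open>A'\<close> is
        applied.\<close>
      hence "c * (c * y $ i + cnj c * z $ i) = 0" by simp
      hence "c\<^sup>2 * y $ i + (c * cnj c) * z $ i = 0" by (simp add: algebra_simps power2_eq_square)
      thus "(c\<^sup>2 \<cdot>\<^sub>v y) $ i = (- z) $ i" using i yz cc by (simp add: eq_neg_iff_add_eq_0)
    qed (use yz in auto)
    hence "A' *\<^sub>v (c\<^sup>2 \<cdot>\<^sub>v y) = A' *\<^sub>v (- z)" by simp
    moreover have "A' *\<^sub>v (c\<^sup>2 \<cdot>\<^sub>v y) = c\<^sup>2 \<cdot>\<^sub>v x"
      using mult_mat_vec[OF A' yz(1)] assoc_mult_mat_vec[OF A' A x(1)] x by (simp add: y_def AA)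
    moreover have "A' *\<^sub>v (- z) = B *\<^sub>v x"
    proof -
      have "B *\<^sub>v x = - (A' *\<^sub>v z)"
        using assoc_mult_mat_vec[OF A' mat_adjoint_carrier[OF A] x(1)] A' A x(1)
        by (simp add: B_def z_def)
      also have "\<dots> = A' *\<^sub>v (- z)" using A' yz by (intro eq_vecI) auto
      finally show ?thesis by simp
    qed
    ultimately have "eigenvector B x (c\<^sup>2)" using B x by (auto simp: eigenvector_def)
    hence "c\<^sup>2 \<in> spectrum B" by (auto simp: spectrum_def eigenvalue_def)
    thus "\<theta> \<in> (\<Union>z\<in>spectrum B. {\<theta> \<in> {a..b}. (exp (- (\<i> * complex_of_real \<theta>)))\<^sup>2 = z})"
      using \<theta> by (auto simp: c_def)
  qed
  moreover have "finite (\<Union>z\<in>spectrum B. {\<theta> \<in> {a..b}. (exp (- (\<i> * complex_of_real \<theta>)))\<^sup>2 = z})"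
    using card_finite_spectrum(1)[OF B] finite_exp_eq_in_interval by blast
  ultimately show ?thesis by (rule finite_subset)
qed

lemma weighted_cyclic_injective:
  assumes w: "\<And>j. j \<in> {1..n} \<Longrightarrow> w j \<noteq> 0" and x: "x \<in> carrier_vec n"
    and 0: "weighted_cyclic_mat n w *\<^sub>v x = 0\<^sub>v n"
  shows "x = 0\<^sub>v n"
proof (rule eq_vecI)
  fix i assume "i < dim_vec (0\<^sub>v n :: complex vec)"
  hence i: "i < n" by simp
  show "x $ i = 0\<^sub>v n $ i"
  proof (cases i)
    case 0
    have "w n * x $ 0 = 0" 
      using weighted_cyclic_mult_vec[OF x, of "n - 1" w] i assms(3) by simp
    thus ?thesis using w[of n] i 0 by simp
  next
    case (Suc j)
    have "w i * x $ i = 0" using weighted_cyclic_mult_vec[OF x, of j w] i assms(3) Suc by simp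
    thus ?thesis using w[of i] i Suc by simp
  qed
qed (use x in auto)

text \<open>At a nonsingular angle the isotropic subspace of dimension n/2 bounds the count below by
  n/2 and above by n - n/2. These agree for even n, so every exceptional angle is a singular
  one.\<close>

lemma num_nonneg_even_weighted_cyclic:
  assumes "even n" and w: "\<And>j. j \<in> {1..n} \<Longrightarrow> w j \<noteq> 0"
  shows "finite {\<theta> \<in> {a..b}. n div 2 \<noteq>
    num_nonneg_eigenvalues (re_part (exp (- (\<i> * complex_of_real \<theta>)) \<cdot>\<^sub>m weighted_cyclic_mat n w))}"
proof -
  let ?A = "weighted_cyclic_mat n w"
  let ?S = "{\<theta> \<in> {a..b}. \<exists>x \<in> carrier_vec n. x \<noteq> 0\<^sub>v n \<and>
    re_part (exp (- (\<i> * complex_of_real \<theta>)) \<cdot>\<^sub>m ?A) *\<^sub>v x = 0\<^sub>v n}"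
  have A: "?A \<in> carrier_mat n n" by simp
  have "n div 2 = num_nonneg_eigenvalues (re_part (exp (- (\<i> * complex_of_real \<theta>)) \<cdot>\<^sub>m ?A))"
    if "\<theta> \<in> {a..b}" "\<theta> \<notin> ?S" for \<theta>
    using that zero_dilation_le_num_nonneg[OF A zero_dilation_weighted_cyclic, of "exp (- (\<i> * complex_of_real \<theta>))"]
      num_nonneg_le_of_zero_dilation[OF A zero_dilation_weighted_cyclic, of "exp (- (\<i> * complex_of_real \<theta>))"]
      assms(1) by fastforce
  hence "{\<theta> \<in> {a..b}. n div 2 \<noteq>
    num_nonneg_eigenvalues (re_part (exp (- (\<i> * complex_of_real \<theta>)) \<cdot>\<^sub>m ?A))} \<subseteq> ?S" by blast
  thus ?thesis
    using finite_singular_re_part[OF A weighted_cyclic_injective[OF w]] by (rule finite_subset)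
qed

section \<open>Odd n: a nonpositive subspace of dimension k + 1\<close>

lemma sum_lessThan_double:
  fixes f :: "nat \<Rightarrow> 'a :: comm_monoid_add"
  shows "(\<Sum>i<2 * k. f i) = (\<Sum>j<k. f (2 * j) + f (2 * j + 1))"
  by (induction k) (auto simp: add.assoc)

text \<open>Here \<open>a\<close> stands for the weights already rotated by e^{-i \<theta>}. The
  sign hypothesis makes the real part of \<open>a n * r k\<close> positive; the form equals minus
  this number times |v_k|^2 on a subspace of dimension k + 1, which leaves room for at most n - (k +
  1) = k nonnegative eigenvalues.\<close>

lemma num_nonneg_odd_weighted_cyclic_le:
  fixes a :: "nat \<Rightarrow> complex"
  assumes n: "n = 2 * k + 1" "k \<ge> 1" and a: "\<And>j. j \<in> {1..n} \<Longrightarrow> a j \<noteq> 0"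
    and sgn: "(- 1) ^ k * Re (\<Prod>i=1..n. a i) < 0"
  shows "num_nonneg_eigenvalues (re_part (weighted_cyclic_mat n a)) \<le> k"
proof -
  let ?B = "weighted_cyclic_mat n a"
  have B: "?B \<in> carrier_mat n n" by simp
  define \<rho> where "\<rho> j = (\<Prod>l\<le>j. (cmod (a (2 * l + 1)))\<^sup>2)" for j
  \<comment> \<open>The extra vector \<open>u\<close> has entry 1 at \<open>2 * k\<close>, \<open>r j\<close> at \<open>2 * j + 1\<close> and 0 elsewhere. Orthogonality to
    \<open>e_0, ..., e_{2k-2}\<close> is the recurrence \<open>r0\<close>, \<open>rS\<close>; \<open>r\<close> is its solution with each factor
    \<open>1 / a (2 * l + 1)\<close> written as a conjugate over a squared modulus, so that its argument is visible.\<close>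
  define r where "r j = (- 1) ^ (j + 1) * cnj (a n * (\<Prod>i=1..2 * j + 1. a i)) / of_real (\<rho> j)" for j
  have nsq: "(complex_of_real (cmod z))\<^sup>2 = z * cnj z" for z
    using complex_norm_square[of z] by simp
  have r0: "a 1 * r 0 = - cnj (a n)"
    using a[of 1] n by (simp add: r_def \<rho>_def nsq field_simps)
  have rS: "a (2 * j + 3) * r (j + 1) = - cnj (a (2 * j + 2)) * r j" if j: "j < k" for j
  proof -
    define p where "p = (\<Prod>i=1..2 * j + 1. a i)"
    define u where "u = a (2 * j + 2)"
    define q where "q = a (2 * j + 3)"
    have p': "(\<Prod>i=1..2 * (j + 1) + 1. a i) = p * u * q"
      unfolding p_def u_def q_def by (simp add: numeral_eq_Suc)
    have \<rho>': "\<rho> (j + 1) = \<rho> j * (cmod q)\<^sup>2"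
      unfolding \<rho>_def q_def by (simp add: numeral_eq_Suc)
    have "q \<noteq> 0" unfolding q_def using a j n by simp
    moreover have "r (j + 1) = (- 1) ^ j * cnj (a n * (p * u * q)) / (of_real (\<rho> j) * (q * cnj q))"
      unfolding r_def p' \<rho>' of_real_mult of_real_power nsq by simp
    moreover have "r j = - ((- 1) ^ j * cnj (a n * p) / of_real (\<rho> j))"
      unfolding r_def p_def by simp
    ultimately show ?thesis
      unfolding u_def[symmetric] q_def[symmetric] by simp
  qed
  have \<rho>: "\<rho> k > 0" unfolding \<rho>_def using a n by (intro prod_pos) auto
  define P where "P = (\<Prod>i=1..n. a i)"
  define c where "c = (- 1) ^ (k + 1) * (cmod (a n))\<^sup>2 / \<rho> k"
  \<comment> \<open>For j = k the product in \<open>r\<close> runs over all weights, as 2 k + 1 = n.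
    One more factor \<open>a n\<close> completes a squared modulus, so only the conjugate of the
    full product carries an argument.\<close>
  have "a n * r k = of_real c * cnj P"
    unfolding r_def c_def P_def of_real_mult of_real_divide complex_norm_square n(1) by simp
  hence "Re (a n * r k) = (- 1) ^ (k + 1) * (cmod (a n))\<^sup>2 / \<rho> k * Re (\<Prod>i=1..n. a i)"
    unfolding c_def[symmetric] P_def[symmetric] by simp
  also have "\<dots> = - ((- 1) ^ k * Re (\<Prod>i=1..n. a i)) * ((cmod (a n))\<^sup>2 / \<rho> k)" by simp
  also have "\<dots> > 0" using sgn \<rho> a[of n] n by (intro mult_pos_pos) auto
  finally have g: "Re (a n * r k) > 0" .
  \<comment> \<open>Columns 0 to k - 1 are e_0, e_2, ..., e_{2k-2}, and column k is
    \<open>u\<close>.\<close>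
  define S where "S = mat n (k + 1) (\<lambda>(i, j). if even i then (if i = 2 * j then 1 else 0)
    else if j = k then r (i div 2) else 0)"
  have S: "S \<in> carrier_mat n (k + 1)" by (simp add: S_def)
  have Sv: "(S *\<^sub>v v) $ i = (if even i then v $ (i div 2) else r (i div 2) * v $ k)"
    if "v \<in> carrier_vec (k + 1)" "i < n" for v i
  proof -
    have "(S *\<^sub>v v) $ i = (\<Sum>j<k + 1. S $$ (i, j) * v $ j)"
      using that S by (simp add: scalar_prod_def atLeast0LessThan)
    also have "\<dots> = (\<Sum>j<k + 1. if j = (if even i then i div 2 else k)
      then (if even i then v $ (i div 2) else r (i div 2) * v $ k) else 0)"
      using that by (intro sum.cong) (auto simp: S_def)
    also have "\<dots> = (if even i then v $ (i div 2) else r (i div 2) * v $ k)"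
      using that n by (subst sum.delta) auto
    finally show ?thesis .
  qed
  \<comment> \<open>The vectors e_0, ..., e_{2k-2} span an isotropic subspace orthogonal to
    \<open>u\<close> for the form, so only the coefficient v_k of \<open>u\<close> survives.\<close>
  have form: "Re ((re_part ?B *\<^sub>v (S *\<^sub>v v)) \<bullet>c (S *\<^sub>v v)) = - Re (a n * r k) * (cmod (v $ k))\<^sup>2"
    if v: "v \<in> carrier_vec (k + 1)" for v
  proof -
    define x where "x = S *\<^sub>v v"
    define t where "t = v $ k"
    have x: "x \<in> carrier_vec n" using mult_mat_vec_carrier[OF S v] by (simp add: x_def)
    have xe: "x $ (2 * j) = v $ j" if "j \<le> k" for j using Sv[OF v, of "2 * j"] that n by (simp add: x_def)
    have xo: "x $ (2 * j + 1) = r j * t" if "j < k" for j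
      using Sv[OF v, of "2 * j + 1"] that n by (simp add: x_def t_def)
    \<comment> \<open>By the recurrence, the terms of the form telescope once every second one is conjugated.\<close>
    define f where "f i = (?B *\<^sub>v x) $ i * cnj (x $ i)" for i
    define T where "T j = a (2 * j + 1) * r j * t * cnj (v $ j)" for j
    have fe: "f (2 * j) = T j" if "j < k" for j
      using weighted_cyclic_mult_vec[OF x, of "2 * j" a] that n xe[of j] xo[of j]
      by (simp add: f_def T_def)
    have fo: "cnj (f (2 * j + 1)) = - T (j + 1)" if "j < k" for j
    proof -
      have "f (2 * j + 1) = a (2 * j + 2) * v $ (j + 1) * cnj (r j * t)"
        using weighted_cyclic_mult_vec[OF x, of "2 * j + 1" a] that n xe[of "j + 1"] xo[of j]
        by (simp add: f_def)
      hence "cnj (f (2 * j + 1)) = (cnj (a (2 * j + 2)) * r j) * t * cnj (v $ (j + 1))" by simp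
      also have "cnj (a (2 * j + 2)) * r j = - (a (2 * j + 3) * r (j + 1))" using rS[OF that] by simp
      finally show ?thesis by (simp add: T_def numeral_3_eq_3)
    qed
    \<comment> \<open>Row 2 k = n - 1 wraps around to x_0 through the corner weight. The initial
      condition \<open>r0\<close> makes its term cancel the first term left by the telescoping
      sum.\<close>
    have fl: "cnj (f (2 * k)) = - T 0"
    proof -
      have "f (2 * k) = a n * v $ 0 * cnj t"
        using weighted_cyclic_mult_vec[OF x, of "2 * k" a] n xe[of k] xe[of 0] by (simp add: f_def t_def)
      thus ?thesis using r0 by (simp add: T_def)
    qed
    have Re_f: "Re (f (2 * j) + f (2 * j + 1)) = - (Re (T (Suc j)) - Re (T j))" if "j < k" for j
      using fe[OF that] arg_cong[OF fo[OF that], of Re] by simp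
    have "(?B *\<^sub>v x) \<bullet>c x = (\<Sum>i<Suc (2 * k). f i)"
      using x n by (simp add: scalar_prod_def atLeast0LessThan f_def del: index_mult_mat_vec sum.lessThan_Suc)
    also have "\<dots> = (\<Sum>j<k. f (2 * j) + f (2 * j + 1)) + f (2 * k)"
      by (simp only: sum.lessThan_Suc sum_lessThan_double)
    finally have "Re ((?B *\<^sub>v x) \<bullet>c x) = (\<Sum>j<k. Re (f (2 * j) + f (2 * j + 1))) + Re (f (2 * k))"
      by simp
    also have "(\<Sum>j<k. Re (f (2 * j) + f (2 * j + 1))) = - (\<Sum>j<k. Re (T (Suc j)) - Re (T j))"
      unfolding sum_negf[symmetric] by (intro sum.cong refl Re_f) simp
    also have "\<dots> = Re (T 0) - Re (T k)" using sum_lessThan_telescope[of "\<lambda>j. Re (T j)" k] by simp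
    also have "Re (f (2 * k)) = - Re (T 0)" using arg_cong[OF fl, of Re] by simp
    \<comment> \<open>\<open>r k\<close> is not an entry of \<open>u\<close>, whose last odd
      position is 2 k - 1. It is the next value of the recurrence, and it measures how far the cycle
      fails to close up.\<close>
    also have "T k = of_real ((cmod t)\<^sup>2) * (a n * r k)"
      unfolding complex_norm_square by (simp add: T_def t_def n)
    finally have "Re ((?B *\<^sub>v x) \<bullet>c x) = - Re (a n * r k) * (cmod t)\<^sup>2" by (simp add: algebra_simps)
    thus ?thesis unfolding Re_cscalar_prod_re_part[OF B x, unfolded x_def] by (simp add: x_def t_def)
  qed
  have "num_nonneg_eigenvalues (re_part ?B) + (k + 1) \<le> n"
  proof (rule num_nonneg_eigenvalues_upper[OF re_part_carrier[OF B] mat_adjoint_re_part[OF B] S])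
    fix v :: "complex vec" assume v: "v \<in> carrier_vec (k + 1)"
    show "Re ((re_part ?B *\<^sub>v (S *\<^sub>v v)) \<bullet>c (S *\<^sub>v v)) \<le> 0"
      unfolding form[OF v] using g by (intro mult_nonpos_nonneg) simp_all
    assume 0: "re_part ?B *\<^sub>v (S *\<^sub>v v) = 0\<^sub>v n"
    define x where "x = S *\<^sub>v v"
    have x: "x \<in> carrier_vec n" using mult_mat_vec_carrier[OF S v] by (simp add: x_def)
    have "Re ((re_part ?B *\<^sub>v x) \<bullet>c x) = 0" using 0 x by (simp add: x_def)
    \<comment> \<open>Strict positivity of the coefficient removes \<open>u\<close>, so
      \<open>x\<close> is supported on even positions.\<close>
    hence vk: "v $ k = 0" using form[OF v] g by (simp add: x_def)
    have Bx: "(?B *\<^sub>v x) $ i + (mat_adjoint ?B *\<^sub>v x) $ i = 0" if "i < n" for i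
    proof -
      have "(re_part ?B *\<^sub>v x) $ i = 1 / 2 * ((?B *\<^sub>v x) $ i + (mat_adjoint ?B *\<^sub>v x) $ i)"
        using that B unfolding re_part_mult_vec[OF B x] 
        by (simp del: index_mult_mat_vec)
      thus ?thesis using 0 that by (simp add: x_def)
    qed
    have xe: "x $ (2 * j) = v $ j" if "j \<le> k" for j using Sv[OF v, of "2 * j"] that n by (simp add: x_def)
    have xo: "x $ i = 0" if "odd i" "i < n" for i using Sv[OF v, of i] that vk by (simp add: x_def)
    \<comment> \<open>The corner weight in row 2 k yields v_0 = 0. Row 2 j + 1 then relates v_j to
      v_{j+1} with a nonzero coefficient at the latter.\<close>
    have "v $ j = 0" if "j \<le> k" for j
      using that
    proof (induction j)
      case 0
      have "(?B *\<^sub>v x) $ (2 * k) = a n * v $ 0"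
        using weighted_cyclic_mult_vec[OF x, of "2 * k" a] n xe[of 0] by simp
      moreover have "(mat_adjoint ?B *\<^sub>v x) $ (2 * k) = 0"
        using adjoint_weighted_cyclic_mult_vec[OF x, of "2 * k" a] n xo[of "2 * k - 1"] by simp
      ultimately show ?case using Bx[of "2 * k"] a[of n] n by simp
    next
      case (Suc j)
      have "(?B *\<^sub>v x) $ (2 * j + 1) = a (2 * j + 2) * v $ Suc j"
        using weighted_cyclic_mult_vec[OF x, of "2 * j + 1" a] n xe[of "Suc j"] Suc.prems by simp
      moreover have "(mat_adjoint ?B *\<^sub>v x) $ (2 * j + 1) = 0"
        using adjoint_weighted_cyclic_mult_vec[OF x, of "2 * j + 1" a] n xe[of j] Suc by simp
      ultimately show ?case using Bx[of "2 * j + 1"] a[of "2 * j + 2"] n Suc.prems by simp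
    qed
    thus "v = 0\<^sub>v (k + 1)" using v by (intro eq_vecI) auto
  qed
  thus ?thesis using n by simp
qed

section \<open>From the sign of the rotated product to the angular intervals\<close>

text \<open>Each factor contributes its argument minus \<theta>, so the product has argument
  \<alpha> - n \<theta>, where \<alpha> is the sum of the arguments; the cosine is even.\<close>

lemma Re_prod_rotated:
  "Re (\<Prod>j=1..n. exp (- (\<i> * complex_of_real \<theta>)) * w j)
    = (\<Prod>j=1..n. cmod (w j)) * cos (real n * \<theta> - (\<Sum>j=1..n. Arg2pi (w j)))"
proof -
  have "exp (- (\<i> * complex_of_real \<theta>)) * w j = of_real (cmod (w j)) * cis (Arg2pi (w j) - \<theta>)" for j
  proof -
    have "w j = of_real (cmod (w j)) * cis (Arg2pi (w j))"
      using Arg2pi_eq[of "w j"] by (simp add: cis_conv_exp)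
    moreover have "exp (- (\<i> * complex_of_real \<theta>)) = cis (- \<theta>)" by (simp add: cis_conv_exp)
    moreover have "cis (- \<theta>) * cis (Arg2pi (w j)) = cis (Arg2pi (w j) - \<theta>)" by (simp add: cis_mult)
    ultimately show ?thesis by (metis mult.left_commute)
  qed
  hence "(\<Prod>j=1..n. exp (- (\<i> * complex_of_real \<theta>)) * w j)
      = of_real (\<Prod>j=1..n. cmod (w j)) * (\<Prod>j=1..n. cis (Arg2pi (w j) - \<theta>))"
    by (simp add: prod.distrib)
  also have "(\<Prod>j=1..n. cis (Arg2pi (w j) - \<theta>)) = cis ((\<Sum>j=1..n. Arg2pi (w j)) - real n * \<theta>)"
    by (induction n) (auto simp: cis_mult algebra_simps)
  finally have eq: "(\<Prod>j=1..n. exp (- (\<i> * complex_of_real \<theta>)) * w j)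
      = of_real (\<Prod>j=1..n. cmod (w j)) * cis ((\<Sum>j=1..n. Arg2pi (w j)) - real n * \<theta>)" .
  show ?thesis
    unfolding eq by (simp add: cos_diff mult.commute del: of_real_prod)
qed

lemma num_nonneg_odd_weighted_cyclic:
  assumes n: "n = 2 * k + 1" "k \<ge> 1" and w: "\<And>j. j \<in> {1..n} \<Longrightarrow> w j \<noteq> 0"
    and sgn: "(- 1) ^ k * cos (real n * \<theta> - (\<Sum>j=1..n. Arg2pi (w j))) < 0"
  shows "num_nonneg_eigenvalues (re_part (exp (- (\<i> * complex_of_real \<theta>)) \<cdot>\<^sub>m weighted_cyclic_mat n w)) = k"
proof (rule antisym)
  let ?c = "exp (- (\<i> * complex_of_real \<theta>))"
  have "(\<Prod>j=1..n. cmod (w j)) > 0" using w by (intro prod_pos) auto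
  hence "(- 1) ^ k * Re (\<Prod>j=1..n. ?c * w j) < 0"
    using sgn unfolding Re_prod_rotated by (metis mult.left_commute mult_pos_neg)
  thus "num_nonneg_eigenvalues (re_part (?c \<cdot>\<^sub>m weighted_cyclic_mat n w)) \<le> k"
    unfolding smult_weighted_cyclic_mat using w
    by (intro num_nonneg_odd_weighted_cyclic_le n) auto
  show "k \<le> num_nonneg_eigenvalues (re_part (?c \<cdot>\<^sub>m weighted_cyclic_mat n w))"
    using zero_dilation_le_num_nonneg[OF weighted_cyclic_carrier[of n w] zero_dilation_weighted_cyclic[of n w], of ?c] n
    by simp
qed

lemma cos_pos_of_mem_interval:
  fixes m :: int
  assumes "x \<in> {- pi / 2 + 2 * of_int m * pi <..< pi / 2 + 2 * of_int m * pi}"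
  shows "cos x > 0"
proof -
  have "cos (x - 2 * of_int m * pi) > 0" using assms by (intro cos_gt_zero_pi) auto
  also have "cos (x - 2 * of_int m * pi) = cos x"
    using cos_int_2pin[of m] sin_int_2pin[of m] by (simp add: cos_diff mult_ac)
  finally show ?thesis .
qed

lemma cos_neg_of_mem_interval:
  fixes m :: int
  assumes "x \<in> {pi / 2 + 2 * of_int m * pi <..< 3 * pi / 2 + 2 * of_int m * pi}"
  shows "cos x < 0"
proof -
  have "cos (x - pi) > 0"
    using assms by (intro cos_pos_of_mem_interval[of _ m]) simp
  thus ?thesis by (simp add: cos_diff)
qed

text \<open>This carries the stated intervals for \<theta> over to intervals for the argument of the
  cosine; \<open>s\<close> takes the shift by a multiple of 2 pi.\<close>

lemma mem_scaled_interval: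
  fixes n :: real
  assumes "n > 0" "\<theta> \<in> {1 / n * (\<alpha> + b + s) <..< 1 / n * (\<alpha> + c + s)}"
  shows "n * \<theta> - \<alpha> \<in> {b + s <..< c + s}"
  using assms by (simp add: pos_divide_less_eq pos_less_divide_eq) (simp add: algebra_simps)

section \<open>The zero-dilation index and the final statement\<close>

lemma zero_dilation_index_weighted_cyclic:
  assumes n: "n \<ge> 2" and w: "\<And>j. j \<in> {1..n} \<Longrightarrow> w j \<noteq> 0"
  shows "zero_dilation_index (weighted_cyclic_mat n w) = n div 2"
proof -
  let ?A = "weighted_cyclic_mat n w"
  \<comment> \<open>One rotation with count n div 2 suffices for the upper bound on the index. For
    even n it is found by removing a finite exceptional set from an infinite interval.\<close>
  obtain c where c: "num_nonneg_eigenvalues (re_part (c \<cdot>\<^sub>m ?A)) = n div 2"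
  proof (cases "even n")
    case True
    have "infinite {0..1::real}" by (simp add: infinite_Icc)
    hence "infinite ({0..1} - {\<theta> \<in> {0..1}. n div 2 \<noteq>
      num_nonneg_eigenvalues (re_part (exp (- (\<i> * complex_of_real \<theta>)) \<cdot>\<^sub>m ?A))})"
      using Diff_infinite_finite[OF num_nonneg_even_weighted_cyclic[OF True, where w = w and a = 0 and b = 1]] w
      by blast
    from infinite_imp_nonempty[OF this] obtain \<theta> where
      "num_nonneg_eigenvalues (re_part (exp (- (\<i> * complex_of_real \<theta>)) \<cdot>\<^sub>m ?A)) = n div 2"
      by fastforce
    thus thesis by (rule that)
  next
    case False
    then obtain k where k: "n = 2 * k + 1" by (elim oddE)
    \<comment> \<open>This angle makes n \<theta> minus the sum of arguments equal to pi or 0, so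
      that its cosine is -1 for even k and 1 for odd k, as the sign condition asks.\<close>
    define \<theta> where "\<theta> = ((\<Sum>j=1..n. Arg2pi (w j)) + (if even k then pi else 0)) / n"
    have "real n * \<theta> - (\<Sum>j=1..n. Arg2pi (w j)) = (if even k then pi else 0)"
      using n by (simp add: \<theta>_def)
    hence "(- 1) ^ k * cos (real n * \<theta> - (\<Sum>j=1..n. Arg2pi (w j))) < 0" by auto
    from num_nonneg_odd_weighted_cyclic[OF k _ w this] show thesis using that k n by simp
  qed
  have zd: "zero_dilation ?A (n div 2)" by (rule zero_dilation_weighted_cyclic)
  have le: "k \<le> n div 2" if "zero_dilation ?A k" for k
    using zero_dilation_le_num_nonneg[OF weighted_cyclic_carrier that, of c] c by simp
  \<comment> \<open>The assumption n >= 2 gives n div 2 >= 1, so the supremum is attained within the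
    range of the definition.\<close>
  have "(GREATEST k. k \<ge> 1 \<and> zero_dilation ?A k) = n div 2"
    using zd le n by (intro Greatest_equality) auto
  moreover have "\<exists>k\<ge>1. zero_dilation ?A k" using zd n by (intro exI[of _ "n div 2"]) auto
  ultimately show ?thesis by (simp add: zero_dilation_index_def)
qed

theorem lemma4p4:
  fixes n :: nat and w :: "nat \<Rightarrow> complex" and A :: "complex mat" and \<alpha> :: real
  assumes "n \<ge> 2"
    and "\<And>j. j \<in> {1..n} \<Longrightarrow> w j \<noteq> 0"
    and "A = weighted_cyclic_mat n w"
    and "\<alpha> = (\<Sum>j=1..n. Arg2pi (w j))"
  shows "zero_dilation_index A = n div 2 \<and>
    (even n \<longrightarrow>
       (\<forall>a b :: real. finite {\<theta> \<in> {a..b}. zero_dilation_index A \<noteq>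
          num_nonneg_eigenvalues (re_part (exp (- (\<i> * complex_of_real \<theta>)) \<cdot>\<^sub>m A))})) \<and>
    (odd n \<and> even ((n - 1) div 2) \<longrightarrow>
       (\<forall>\<theta> \<in> (\<Union>m :: int. {1 / real n * (\<alpha> + pi / 2 + 2 * real_of_int m * pi) <..<
                            1 / real n * (\<alpha> + 3 * pi / 2 + 2 * real_of_int m * pi)}).
          zero_dilation_index A =
          num_nonneg_eigenvalues (re_part (exp (- (\<i> * complex_of_real \<theta>)) \<cdot>\<^sub>m A)))) \<and>
    (odd n \<and> odd ((n - 1) div 2) \<longrightarrow>
       (\<forall>\<theta> \<in> (\<Union>m :: int. {1 / real n * (\<alpha> - pi / 2 + 2 * real_of_int m * pi) <..<
                            1 / real n * (\<alpha> + pi / 2 + 2 * real_of_int m * pi)}).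
          zero_dilation_index A =
          num_nonneg_eigenvalues (re_part (exp (- (\<i> * complex_of_real \<theta>)) \<cdot>\<^sub>m A))))"
proof -
  note w = assms(2) and A = assms(3) and \<alpha> = assms(4)
  have d: "zero_dilation_index A = n div 2"
    unfolding A by (rule zero_dilation_index_weighted_cyclic[OF assms(1) w])
  have n0: "real n > 0" using assms(1) by simp
  \<comment> \<open>Both families of intervals express this one sign condition, according to the
    parity of (n - 1) / 2.\<close>
  have odd_case: "n div 2 = num_nonneg_eigenvalues (re_part (exp (- (\<i> * complex_of_real \<theta>)) \<cdot>\<^sub>m A))"
    if "odd n" "(- 1) ^ ((n - 1) div 2) * cos (real n * \<theta> - \<alpha>) < 0" for \<theta>
  proof -
    from \<open>odd n\<close> obtain k where k: "n = 2 * k + 1" by (elim oddE)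
    show ?thesis
      using num_nonneg_odd_weighted_cyclic[OF k _ w, where \<theta> = \<theta>] that assms(1) k unfolding A \<alpha> by simp
  qed
  show ?thesis
    unfolding d
  proof (intro conjI impI allI ballI refl)
    fix a b :: real assume "even n"
    thus "finite {\<theta> \<in> {a..b}. n div 2 \<noteq>
        num_nonneg_eigenvalues (re_part (exp (- (\<i> * complex_of_real \<theta>)) \<cdot>\<^sub>m A))}"
      unfolding A using w by (rule num_nonneg_even_weighted_cyclic)
  next
    fix \<theta> assume odd: "odd n \<and> even ((n - 1) div 2)"
      and "\<theta> \<in> (\<Union>m :: int. {1 / real n * (\<alpha> + pi / 2 + 2 * real_of_int m * pi) <..<
                            1 / real n * (\<alpha> + 3 * pi / 2 + 2 * real_of_int m * pi)})"
    then obtain m :: int where "\<theta> \<in> {1 / real n * (\<alpha> + pi / 2 + 2 * real_of_int m * pi) <..<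
                            1 / real n * (\<alpha> + 3 * pi / 2 + 2 * real_of_int m * pi)}" by blast
    from cos_neg_of_mem_interval[OF mem_scaled_interval[OF n0 this]] odd
    show "n div 2 = num_nonneg_eigenvalues (re_part (exp (- (\<i> * complex_of_real \<theta>)) \<cdot>\<^sub>m A))"
      by (intro odd_case) auto
  next
    fix \<theta> assume odd: "odd n \<and> odd ((n - 1) div 2)"
      and "\<theta> \<in> (\<Union>m :: int. {1 / real n * (\<alpha> - pi / 2 + 2 * real_of_int m * pi) <..<
                            1 / real n * (\<alpha> + pi / 2 + 2 * real_of_int m * pi)})"
    \<comment> \<open>The difference is rewritten as a sum with - pi / 2 to fit the form of
      \<open>mem_scaled_interval\<close>.\<close>
    then obtain m :: int where "\<theta> \<in> {1 / real n * (\<alpha> + - pi / 2 + 2 * real_of_int m * pi) <..<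
                            1 / real n * (\<alpha> + pi / 2 + 2 * real_of_int m * pi)}" by auto
    from cos_pos_of_mem_interval[OF mem_scaled_interval[OF n0 this]] odd
    show "n div 2 = num_nonneg_eigenvalues (re_part (exp (- (\<i> * complex_of_real \<theta>)) \<cdot>\<^sub>m A))"
      by (intro odd_case) auto
  qed
qed

end
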